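(* Let $N=n_1\cdots n_d$ with $n_1,\dots,n_d$ positive integers. Then $$\mathcal{L}(\mathbb{R}^{N\times N})=\mathrm{span}\{\mathrm{id}_N\}\oplus\Delta,$$ where $\Delta=\mathrm{span}\{\mathrm{id}_N\}^{\bot}\cap\mathcal{L}(\mathbb{R}^{N\times N})$. Furthermore, $\mathcal{L}(\mathbb{R}^{N\times N})^{\bot}$ is a subspace of $\mathrm{span}\{\mathrm{id}_N\}^{\bot}$.
   Context: Fix a factorization $N=n_1\cdots n_d$; $\otimes$ denotes the Kronecker product of matrices and $\mathrm{id}_n$ the $n\times n$ identity matrix. A matrix $A\in\mathbb{R}^{N\times N}$ is Laplacian-like if there exist $A_i\in\mathbb{R}^{n_i\times n_i}$, $1\le i\le d$, such that $A=\sum_{i=1}^d \mathrm{id}_{n_1}\otimes\cdots\otimes\mathrm{id}_{n_{i-1}}\otimes A_i\otimes\mathrm{id}_{n_{i+1}}\otimes\cdots\otimes\mathrm{id}_{n_d}$. The set of Laplacian-like matrices (for the fixed factorization) is a linear subspace denoted $\mathcal{L}(\mathbb{R}^{N\times N})$. The space $\mathbb{R}^{N\times N}$ carries the inner product $\langle A,B\rangle=\mathrm{tr}(A^{\top}B)$, and for a linear subspace $\mathcal{U}\subset\mathbb{R}^{N\times N}$, $\mathcal{U}^{\bot}$ denotes its orthogonal complement in $\mathbb{R}^{N\times N}$ with respect to this inner product. *)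

theory Defs
  imports "Jordan_Normal_Form.VS_Connect"
begin

abbreviation mat_space :: "nat \<Rightarrow> (real, real mat) module" where
  "mat_space N \<equiv> module_mat TYPE(real) N N"

abbreviation mat_span :: "nat \<Rightarrow> real mat set \<Rightarrow> real mat set" where
  "mat_span N \<equiv> LinearCombinations.module.span class_ring (mat_space N)"

text \<open>Rows and columns of the product are numbered lexicographically, from 0.\<close>

definition kronecker :: "real mat \<Rightarrow> real mat \<Rightarrow> real mat" where
  "kronecker A B =
     mat (dim_row A * dim_row B) (dim_col A * dim_col B)
       (\<lambda>(i, j). A $$ (i div dim_row B, j div dim_col B) * B $$ (i mod dim_row B, j mod dim_col B))"

definition kronecker_list :: "real mat list \<Rightarrow> real mat" where
  "kronecker_list As = foldr kronecker As (1\<^sub>m 1)"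

text \<open>
  The factorization $N = n_1 \cdots n_d$ is given by the list \<open>ns\<close> of the factors, with indices
  shifted to $0, \ldots, d - 1$. The \<open>i\<close>-th summand is the Kronecker product of identity
  matrices in which the \<open>i\<close>-th factor is replaced by \<open>A\<close>.
\<close>

definition laplacian_term :: "nat list \<Rightarrow> nat \<Rightarrow> real mat \<Rightarrow> real mat" where
  "laplacian_term ns i A = kronecker_list ((map 1\<^sub>m ns)[i := A])"

definition laplacian_like :: "nat list \<Rightarrow> real mat \<Rightarrow> bool" where
  "laplacian_like ns A \<longleftrightarrow>
     (\<exists>As. (\<forall>i<length ns. As i \<in> carrier_mat (ns ! i) (ns ! i)) \<and>
           A = (\<Oplus>\<^bsub>mat_space (prod_list ns)\<^esub> i \<in> {..<length ns}. laplacian_term ns i (As i)))"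

definition laplacian_space :: "nat list \<Rightarrow> real mat set" where
  "laplacian_space ns = {A \<in> carrier_mat (prod_list ns) (prod_list ns). laplacian_like ns A}"

definition mat_trace :: "real mat \<Rightarrow> real" where
  "mat_trace A = (\<Sum>i<dim_row A. A $$ (i, i))"

definition mat_inner :: "real mat \<Rightarrow> real mat \<Rightarrow> real" where
  "mat_inner A B = mat_trace (transpose_mat A * B)"

definition orth_complement :: "nat \<Rightarrow> real mat set \<Rightarrow> real mat set" where
  "orth_complement N U = {A \<in> carrier_mat N N. \<forall>B\<in>U. mat_inner A B = 0}"

text \<open>\<open>W\<close> is the internal direct sum of the subspaces \<open>U1\<close> and \<open>U2\<close> of \<open>V\<close>.\<close>

definition internal_direct_sum ::
  "'a ring \<Rightarrow> ('a, 'v) module \<Rightarrow> 'v set \<Rightarrow> 'v set \<Rightarrow> 'v set \<Rightarrow> bool" where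
  "internal_direct_sum K V W U1 U2 \<longleftrightarrow>
     VectorSpace.subspace K U1 V \<and> VectorSpace.subspace K U2 V \<and>
     W = LinearCombinations.module.submodule_sum V U1 U2 \<and> U1 \<inter> U2 = {\<zero>\<^bsub>V\<^esub>}"

end

theory Submission
  imports Defs
begin

section \<open>Kronecker products\<close>

text \<open>The identity is itself Laplacian-like: put the identity in one slot and zero matrices in
  all the others. The i-th summand depends linearly on its matrix, because the Kronecker product is
  bilinear, so the Laplacian-like matrices form a linear space L that contains the line S spanned by
  the identity.

  The rest is orthogonal projection onto S inside L. Since the identity of size N has squared norm N
  > 0, every A in L equals c * id + D with c = tr(A) / N, where D is orthogonal to the identity. As
  L contains both A and the identity, D stays in L, hence in \<open>\<Delta>\<close>. A multiple c *
  id in \<open>\<Delta>\<close> satisfies c * N = 0 and therefore vanishes, so the sum is direct.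
  Finally, taking orthogonal complements reverses the inclusion of S in L.

  The facts about L are \<open>one_in_laplacian_space\<close>, \<open>laplacian_space_add\<close>
  and \<open>laplacian_space_smult\<close>; the orthogonality to S is reduced to a single equation
  by \<open>orth_complement_span_one\<close>.\<close>

lemma kronecker_carrier [simp, intro]:
  assumes "A \<in> carrier_mat m n" "B \<in> carrier_mat p q"
  shows "kronecker A B \<in> carrier_mat (m * p) (n * q)"
  using assms by (auto simp: kronecker_def)

lemma kronecker_index:
  assumes "A \<in> carrier_mat m n" "B \<in> carrier_mat p q" "i < m * p" "j < n * q"
  shows "kronecker A B $$ (i, j) = A $$ (i div p, j div q) * B $$ (i mod p, j mod q)"
    and "i div p < m" "j div q < n" "i mod p < p" "j mod q < q"
proof -
  \<comment> \<open>With p = 0 or q = 0 the product would have no rows or no columns, against the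
    choice of i and j. Positivity is what bounds the remainders.\<close>
  have "0 < p" "0 < q"
    using assms(3,4) by (auto intro: Nat.gr0I)
  then show "i mod p < p" "j mod q < q"
    by simp_all
  show "kronecker A B $$ (i, j) = A $$ (i div p, j div q) * B $$ (i mod p, j mod q)"
    using assms by (auto simp: kronecker_def)
  show "i div p < m" "j div q < n"
    using assms(3,4) by (simp_all add: less_mult_imp_div_less)
qed

section \<open>Bilinearity of the Kronecker product, and products of identities\<close>

lemma kronecker_add_left:
  assumes "A \<in> carrier_mat m n" "B \<in> carrier_mat m n" "C \<in> carrier_mat p q"
  shows "kronecker (A + B) C = kronecker A C + kronecker B C"
proof (rule eq_matI)
  have AB: "A + B \<in> carrier_mat m n" using assms by simp
  have sum: "kronecker A C + kronecker B C \<in> carrier_mat (m * p) (n * q)"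
    using assms by auto
  show "dim_row (kronecker (A + B) C) = dim_row (kronecker A C + kronecker B C)"
    "dim_col (kronecker (A + B) C) = dim_col (kronecker A C + kronecker B C)"
    using sum kronecker_carrier[OF AB assms(3)] by (metis carrier_matD)+
  fix i j
  assume "i < dim_row (kronecker A C + kronecker B C)" "j < dim_col (kronecker A C + kronecker B C)"
  then have ij: "i < m * p" "j < n * q" using sum by auto
  show "kronecker (A + B) C $$ (i, j) = (kronecker A C + kronecker B C) $$ (i, j)"
    using carrier_matD[OF kronecker_carrier[OF assms(2,3)]] assms ij
      kronecker_index[OF assms(1,3) ij] kronecker_index[OF assms(2,3) ij]
      kronecker_index[OF AB assms(3) ij]
    by (auto simp: algebra_simps)
qed

lemma kronecker_add_right:
  assumes "C \<in> carrier_mat m n" "A \<in> carrier_mat p q" "B \<in> carrier_mat p q"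
  shows "kronecker C (A + B) = kronecker C A + kronecker C B"
proof (rule eq_matI)
  have AB: "A + B \<in> carrier_mat p q" using assms by simp
  have sum: "kronecker C A + kronecker C B \<in> carrier_mat (m * p) (n * q)"
    using assms by auto
  show "dim_row (kronecker C (A + B)) = dim_row (kronecker C A + kronecker C B)"
    "dim_col (kronecker C (A + B)) = dim_col (kronecker C A + kronecker C B)"
    using sum kronecker_carrier[OF assms(1) AB] by (metis carrier_matD)+
  fix i j
  assume "i < dim_row (kronecker C A + kronecker C B)" "j < dim_col (kronecker C A + kronecker C B)"
  then have ij: "i < m * p" "j < n * q" using sum by auto
  show "kronecker C (A + B) $$ (i, j) = (kronecker C A + kronecker C B) $$ (i, j)"
    using carrier_matD[OF kronecker_carrier[OF assms(1,3)]] assms ij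
      kronecker_index[OF assms(1,2) ij] kronecker_index[OF assms(1,3) ij]
      kronecker_index[OF assms(1) AB ij]
    by (auto simp: algebra_simps)
qed

lemma kronecker_smult_left: "kronecker (c \<cdot>\<^sub>m A) C = c \<cdot>\<^sub>m kronecker A C"
  by (rule eq_matI) (auto simp: kronecker_def less_mult_imp_div_less)

lemma kronecker_smult_right: "kronecker C (c \<cdot>\<^sub>m A) = c \<cdot>\<^sub>m kronecker C A"
proof (rule eq_matI)
  fix i j
  assume "i < dim_row (c \<cdot>\<^sub>m kronecker C A)" "j < dim_col (c \<cdot>\<^sub>m kronecker C A)"
  then have ij: "i < dim_row C * dim_row A" "j < dim_col C * dim_col A"
    by (auto simp: kronecker_def)
  \<comment> \<open>Scaling acts entrywise only within the dimensions of \<open>A\<close>, hence the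
    bounds on the remainders.\<close>
  show "kronecker C (c \<cdot>\<^sub>m A) $$ (i, j) = (c \<cdot>\<^sub>m kronecker C A) $$ (i, j)"
    using ij kronecker_index(4,5)[of C _ _ A, OF carrier_matI carrier_matI ij]
    by (auto simp: kronecker_def)
qed (auto simp: kronecker_def)

text \<open>An entry is a product of two Kronecker deltas, one comparing quotients and one comparing
  remainders modulo n. Together these determine the index.\<close>

lemma kronecker_one: "kronecker (1\<^sub>m m) (1\<^sub>m n) = 1\<^sub>m (m * n)"
proof (rule eq_matI)
  fix i j
  assume "i < dim_row (1\<^sub>m (m * n) :: real mat)" "j < dim_col (1\<^sub>m (m * n) :: real mat)"
  then have ij: "i < m * n" "j < m * n"
    by auto
  have "i = j \<longleftrightarrow> i div n = j div n \<and> i mod n = j mod n"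
    by (metis div_mult_mod_eq)
  then show "kronecker (1\<^sub>m m) (1\<^sub>m n) $$ (i, j) = 1\<^sub>m (m * n) $$ (i, j)"
    using ij kronecker_index[OF one_carrier_mat one_carrier_mat ij] by auto
qed (auto simp: kronecker_def)

lemma kronecker_list_one: "kronecker_list (map 1\<^sub>m ns) = 1\<^sub>m (prod_list ns)"
  by (induction ns) (simp_all add: kronecker_list_def kronecker_one)

section \<open>Laplacian-like matrices\<close>

text \<open>Peeling off the first factor drives the inductions below: the distinguished slot is
  either the head, followed by one large identity, or lies in the tail behind an identity.\<close>

lemma laplacian_term_Cons:
  "laplacian_term (n # ns) 0 A = kronecker A (1\<^sub>m (prod_list ns))"
  "laplacian_term (n # ns) (Suc i) A = kronecker (1\<^sub>m n) (laplacian_term ns i A)"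
  by (simp_all add: laplacian_term_def kronecker_list_def flip: kronecker_list_one)

lemma laplacian_term_carrier:
  assumes "i < length ns" "A \<in> carrier_mat (ns ! i) (ns ! i)"
  shows "laplacian_term ns i A \<in> carrier_mat (prod_list ns) (prod_list ns)"
  using assms
proof (induction ns arbitrary: i)
  case (Cons n ns)
  then show ?case
    by (cases i) (auto simp: laplacian_term_Cons)
qed simp

lemma laplacian_term_add:
  assumes "i < length ns" "A \<in> carrier_mat (ns ! i) (ns ! i)" "B \<in> carrier_mat (ns ! i) (ns ! i)"
  shows "laplacian_term ns i (A + B) = laplacian_term ns i A + laplacian_term ns i B"
  using assms
proof (induction ns arbitrary: i)
  case (Cons n ns)
  show ?case
  proof (cases i)
    case 0
    then show ?thesis
      using Cons.prems kronecker_add_left[OF _ _ one_carrier_mat]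
      by (simp add: laplacian_term_Cons)
  next
    case (Suc k)
    then show ?thesis
      using Cons kronecker_add_right[OF one_carrier_mat laplacian_term_carrier laplacian_term_carrier]
      by (simp add: laplacian_term_Cons)
  qed
qed simp

lemma laplacian_term_smult:
  assumes "i < length ns"
  shows "laplacian_term ns i (c \<cdot>\<^sub>m A) = c \<cdot>\<^sub>m laplacian_term ns i A"
  using assms
proof (induction ns arbitrary: i)
  case (Cons n ns)
  then show ?case
    by (cases i) (simp_all add: laplacian_term_Cons kronecker_smult_left kronecker_smult_right)
qed simp

text \<open>This is homogeneity with the scalar 0; the carrier of the summand fixes the dimensions
  of the resulting zero matrix.\<close>

lemma laplacian_term_zero:
  assumes "i < length ns"
  shows "laplacian_term ns i (0\<^sub>m (ns ! i) (ns ! i)) = 0\<^sub>m (prod_list ns) (prod_list ns)"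
proof -
  let ?Z = "0\<^sub>m (ns ! i) (ns ! i) :: real mat"
  have "laplacian_term ns i (0 \<cdot>\<^sub>m ?Z) = 0 \<cdot>\<^sub>m laplacian_term ns i ?Z"
    using assms by (rule laplacian_term_smult)
  moreover have "0 \<cdot>\<^sub>m ?Z = ?Z"
    by auto
  moreover have "0 \<cdot>\<^sub>m laplacian_term ns i ?Z = 0\<^sub>m (prod_list ns) (prod_list ns)"
    using laplacian_term_carrier[OF assms, of ?Z] by auto
  ultimately show ?thesis
    by simp
qed

lemma laplacian_term_one:
  assumes "i < length ns"
  shows "laplacian_term ns i (1\<^sub>m (ns ! i)) = 1\<^sub>m (prod_list ns)"
proof -
  have "(map 1\<^sub>m ns)[i := 1\<^sub>m (ns ! i) :: real mat] = map 1\<^sub>m ns"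
    using assms by (metis list_update_id map_update)
  then show ?thesis
    by (simp add: laplacian_term_def kronecker_list_one)
qed

section \<open>The linear structure of the set of Laplacian-like matrices\<close>

lemma laplacian_spaceI:
  assumes "\<And>i. i < length ns \<Longrightarrow> As i \<in> carrier_mat (ns ! i) (ns ! i)"
    and "A = (\<Oplus>\<^bsub>mat_space (prod_list ns)\<^esub> i \<in> {..<length ns}. laplacian_term ns i (As i))"
  shows "A \<in> laplacian_space ns"
proof -
  interpret V: matrix_vs "prod_list ns" "prod_list ns" "TYPE(real)" .
  have "A \<in> carrier_mat (prod_list ns) (prod_list ns)"
    unfolding assms(2) by (rule V.finsum_closed) (auto intro!: laplacian_term_carrier assms(1))
  then show ?thesis
    using assms unfolding laplacian_space_def laplacian_like_def by blast
qed

text \<open>At least one slot must exist to hold the identity: for an empty list the sum is empty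
  and yields only the zero matrix of size 1.\<close>

lemma one_in_laplacian_space:
  assumes "ns \<noteq> []"
  shows "1\<^sub>m (prod_list ns) \<in> laplacian_space ns"
proof -
  let ?N = "prod_list ns"
  interpret V: matrix_vs ?N ?N "TYPE(real)" .
  \<comment> \<open>Slot 0 carries the identity and all others vanish, so the sum collapses to its
    first summand.\<close>
  let ?As = "\<lambda>i. if 0 = i then 1\<^sub>m (ns ! i) else 0\<^sub>m (ns ! i) (ns ! i) :: real mat"
  have "(\<Oplus>\<^bsub>mat_space ?N\<^esub> i \<in> {..<length ns}. laplacian_term ns i (?As i))
      = (\<Oplus>\<^bsub>mat_space ?N\<^esub> i \<in> {..<length ns}. if 0 = i then 1\<^sub>m ?N else 0\<^sub>m ?N ?N)"
    by (rule V.finsum_cong') (auto simp: laplacian_term_zero laplacian_term_one)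
  also have "\<dots> = 1\<^sub>m ?N"
    using assms V.finsum_singleton[of 0 "{..<length ns}" "\<lambda>_. 1\<^sub>m ?N"] by simp
  finally show ?thesis
    by (intro laplacian_spaceI[of _ ?As]) simp_all
qed

lemma laplacian_space_add:
  assumes "A \<in> laplacian_space ns" "B \<in> laplacian_space ns"
  shows "A + B \<in> laplacian_space ns"
proof -
  let ?N = "prod_list ns" and ?I = "{..<length ns}"
  interpret V: matrix_vs ?N ?N "TYPE(real)" .
  obtain As where As: "\<And>i. i < length ns \<Longrightarrow> As i \<in> carrier_mat (ns ! i) (ns ! i)"
      "A = (\<Oplus>\<^bsub>mat_space ?N\<^esub> i \<in> ?I. laplacian_term ns i (As i))"
    using assms(1) unfolding laplacian_space_def laplacian_like_def by blast
  obtain Bs where Bs: "\<And>i. i < length ns \<Longrightarrow> Bs i \<in> carrier_mat (ns ! i) (ns ! i)"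
      "B = (\<Oplus>\<^bsub>mat_space ?N\<^esub> i \<in> ?I. laplacian_term ns i (Bs i))"
    using assms(2) unfolding laplacian_space_def laplacian_like_def by blast
  have "A + B = (\<Oplus>\<^bsub>mat_space ?N\<^esub> i \<in> ?I. laplacian_term ns i (As i) + laplacian_term ns i (Bs i))"
    unfolding As(2) Bs(2)
    by (rule V.finsum_addf[symmetric]) (use As(1) Bs(1) in \<open>auto intro!: laplacian_term_carrier\<close>)
  also have "\<dots> = (\<Oplus>\<^bsub>mat_space ?N\<^esub> i \<in> ?I. laplacian_term ns i (As i + Bs i))"
    by (rule V.finsum_cong')
      (use As(1) Bs(1) in \<open>auto intro!: laplacian_term_carrier simp: laplacian_term_add\<close>)
  finally show ?thesis
    by (rule laplacian_spaceI[rotated]) (simp add: As(1) Bs(1))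
qed

lemma laplacian_space_smult:
  assumes "A \<in> laplacian_space ns"
  shows "c \<cdot>\<^sub>m A \<in> laplacian_space ns"
proof -
  let ?N = "prod_list ns" and ?I = "{..<length ns}"
  interpret V: matrix_vs ?N ?N "TYPE(real)" .
  obtain As where As: "\<And>i. i < length ns \<Longrightarrow> As i \<in> carrier_mat (ns ! i) (ns ! i)"
      "A = (\<Oplus>\<^bsub>mat_space ?N\<^esub> i \<in> ?I. laplacian_term ns i (As i))"
    using assms unfolding laplacian_space_def laplacian_like_def by blast
  have "c \<cdot>\<^sub>m A = (\<Oplus>\<^bsub>mat_space ?N\<^esub> i \<in> ?I. c \<cdot>\<^sub>m laplacian_term ns i (As i))"
    unfolding As(2)
    by (rule V.finsum_smult) (use As(1) in \<open>auto intro!: laplacian_term_carrier\<close>)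
  also have "\<dots> = (\<Oplus>\<^bsub>mat_space ?N\<^esub> i \<in> ?I. laplacian_term ns i (c \<cdot>\<^sub>m As i))"
    by (rule V.finsum_cong')
      (use As(1) in \<open>auto intro!: laplacian_term_carrier simp: laplacian_term_smult\<close>)
  finally show ?thesis
    by (rule laplacian_spaceI[rotated]) (simp add: As(1))
qed

section \<open>Subspaces and orthogonal complements\<close>

lemma mat_subspaceI:
  assumes "U \<subseteq> carrier_mat N N" "0\<^sub>m N N \<in> U"
    and "\<And>A B. A \<in> U \<Longrightarrow> B \<in> U \<Longrightarrow> A + B \<in> U"
    and "\<And>c A. A \<in> U \<Longrightarrow> c \<cdot>\<^sub>m A \<in> U"
  shows "VectorSpace.subspace class_ring U (mat_space N)"
proof -
  have "LinearCombinations.submodule class_ring U (mat_space N)"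
    using assms matrix_vs[of N N]
    by (auto simp: LinearCombinations.submodule_def vectorspace_def module_mat_simps)
  then show ?thesis
    by (intro VectorSpace.subspace.intro matrix_vs)
qed

text \<open>The trace form is the Euclidean inner product of the entries; bilinearity is then read
  off from finite sums.\<close>

lemma mat_inner_eq:
  assumes "A \<in> carrier_mat N N" "B \<in> carrier_mat N N"
  shows "mat_inner A B = (\<Sum>i<N. \<Sum>k<N. A $$ (k, i) * B $$ (k, i))"
  using assms
  by (auto simp: mat_inner_def mat_trace_def scalar_prod_def atLeast0LessThan intro!: sum.cong)

lemma mat_inner_add:
  assumes "A \<in> carrier_mat N N" "B \<in> carrier_mat N N" "C \<in> carrier_mat N N"
  shows "mat_inner (A + B) C = mat_inner A C + mat_inner B C"
  using assms by (simp add: mat_inner_eq[of _ N] sum.distrib algebra_simps)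

lemma mat_inner_smult:
  assumes "A \<in> carrier_mat N N" "C \<in> carrier_mat N N"
  shows "mat_inner (c \<cdot>\<^sub>m A) C = c * mat_inner A C" "mat_inner A (c \<cdot>\<^sub>m C) = c * mat_inner A C"
  using assms by (simp_all add: mat_inner_eq[of _ N] sum_distrib_left algebra_simps)

lemma mat_inner_zero:
  assumes "C \<in> carrier_mat N N"
  shows "mat_inner (0\<^sub>m N N) C = 0"
  using assms by (simp add: mat_inner_eq[of _ N])

lemma mat_inner_one: "mat_inner (1\<^sub>m N) (1\<^sub>m N) = real N"
  by (simp add: mat_inner_def mat_trace_def)

section \<open>Orthogonal complements as subspaces\<close>

lemma orth_complement_add:
  assumes "U \<subseteq> carrier_mat N N" "A \<in> orth_complement N U" "B \<in> orth_complement N U"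
  shows "A + B \<in> orth_complement N U"
  using assms by (auto simp: orth_complement_def mat_inner_add[of _ N] subset_iff)

lemma orth_complement_smult:
  assumes "U \<subseteq> carrier_mat N N" "A \<in> orth_complement N U"
  shows "c \<cdot>\<^sub>m A \<in> orth_complement N U"
  using assms by (auto simp: orth_complement_def mat_inner_smult[of _ N] subset_iff)

lemma zero_in_orth_complement:
  assumes "U \<subseteq> carrier_mat N N"
  shows "0\<^sub>m N N \<in> orth_complement N U"
  using assms by (auto simp: orth_complement_def mat_inner_zero subset_iff)

lemma orth_complement_subspace:
  assumes "U \<subseteq> carrier_mat N N"
  shows "VectorSpace.subspace class_ring (orth_complement N U) (mat_space N)"
  using assms
  by (intro mat_subspaceI orth_complement_add orth_complement_smult zero_in_orth_complement)
    (auto simp: orth_complement_def)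

lemma orth_complement_antimono:
  assumes "U \<subseteq> W"
  shows "orth_complement N W \<subseteq> orth_complement N U"
  using assms by (auto simp: orth_complement_def)

section \<open>The line spanned by the identity\<close>

lemma mat_span_one: "mat_span N {1\<^sub>m N} = range (\<lambda>c. c \<cdot>\<^sub>m 1\<^sub>m N)"
proof -
  interpret V: matrix_vs N N "TYPE(real)" .
  have "V.span {1\<^sub>m N} = {V.lincomb a {1\<^sub>m N} |a. a \<in> {1\<^sub>m N} \<rightarrow> UNIV}"
    by (rule V.finite_span) auto
  also have "\<dots> = {a (1\<^sub>m N :: real mat) \<cdot>\<^sub>m 1\<^sub>m N | a. True}"
    by (auto simp: V.lincomb_def)
  also have "\<dots> = range (\<lambda>c. c \<cdot>\<^sub>m 1\<^sub>m N)"
  proof safe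
    fix c :: real
    show "\<exists>a. c \<cdot>\<^sub>m 1\<^sub>m N = a (1\<^sub>m N :: real mat) \<cdot>\<^sub>m 1\<^sub>m N \<and> True"
      by (rule exI[of _ "\<lambda>_. c"]) simp
  qed auto
  finally show ?thesis .
qed

lemma orth_complement_span_one:
  "orth_complement N (mat_span N {1\<^sub>m N}) = {A \<in> carrier_mat N N. mat_inner A (1\<^sub>m N) = 0}"
proof -
  \<comment> \<open>The case c = 1 recovers the single equation; conversely, homogeneity in the
    second argument extends it to the whole line.\<close>
  have "mat_inner A (1\<^sub>m N) = 0" if "\<forall>c. mat_inner A (c \<cdot>\<^sub>m 1\<^sub>m N) = 0" "A \<in> carrier_mat N N" for A
    using that(1)[rule_format, of 1] that(2) by (simp add: mat_inner_smult(2)[of _ N])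
  then show ?thesis
    by (auto simp: orth_complement_def mat_span_one mat_inner_smult(2)[of _ N])
qed

theorem theorem1:
  fixes ns :: "nat list" and N :: nat and \<Delta> :: "real mat set"
  assumes "ns \<noteq> []"
    and "\<forall>n\<in>set ns. n > 0"
    and "N = prod_list ns"
    and "\<Delta> = orth_complement N (mat_span N {1\<^sub>m N}) \<inter> laplacian_space ns"
  shows "internal_direct_sum class_ring (mat_space N) (laplacian_space ns) (mat_span N {1\<^sub>m N}) \<Delta>
    \<and> VectorSpace.subspace class_ring (orth_complement N (laplacian_space ns))
        ((mat_space N)\<lparr>carrier := orth_complement N (mat_span N {1\<^sub>m N})\<rparr>)"
proof -
  interpret V: matrix_vs N N "TYPE(real)" .
  let ?S = "mat_span N {1\<^sub>m N}" and ?L = "laplacian_space ns"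
  have N: "N > 0"
    unfolding assms(3) using assms(2) by (induction ns) auto
  have S_carrier: "?S \<subseteq> carrier_mat N N"
    by (auto simp: mat_span_one)
  have L_carrier: "?L \<subseteq> carrier_mat N N"
    by (auto simp: laplacian_space_def assms(3))
  have S_L: "?S \<subseteq> ?L"
    using one_in_laplacian_space[OF assms(1)]
    by (auto simp: mat_span_one assms(3) intro: laplacian_space_smult)
  have S_subspace: "VectorSpace.subspace class_ring ?S (mat_space N)"
    using V.span_is_subspace[of "{1\<^sub>m N}"] by simp
  then have zero_L: "0\<^sub>m N N \<in> ?L"
    using S_L
    by (auto simp: VectorSpace.subspace_def LinearCombinations.submodule_def module_mat_simps)
  have \<Delta>_subspace: "VectorSpace.subspace class_ring \<Delta> (mat_space N)"
    unfolding assms(4) using L_carrier zero_L zero_in_orth_complement[OF S_carrier]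
    by (intro mat_subspaceI)
      (auto intro: laplacian_space_add laplacian_space_smult
        orth_complement_add[OF S_carrier] orth_complement_smult[OF S_carrier])
  have "\<exists>c D. A = c \<cdot>\<^sub>m 1\<^sub>m N + D \<and> D \<in> \<Delta>" if A: "A \<in> ?L" for A
  proof -
    \<comment> \<open>This is the coefficient of the orthogonal projection of \<open>A\<close> onto
      the identity, whose squared norm is N; \<open>D\<close> is the residual.\<close>
    define c where "c = mat_inner A (1\<^sub>m N) / real N"
    define D where "D = A + (- c) \<cdot>\<^sub>m 1\<^sub>m N"
    have A_carrier: "A \<in> carrier_mat N N"
      using A L_carrier by auto
    have "mat_inner D (1\<^sub>m N) = 0"
      using A_carrier N unfolding D_def c_def
      by (simp add: mat_inner_add[of _ N] mat_inner_smult[of _ N] mat_inner_one)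
    moreover have "D \<in> ?L"
      unfolding D_def using A S_L by (intro laplacian_space_add) (auto simp: mat_span_one)
    ultimately have "D \<in> \<Delta>"
      using L_carrier by (auto simp: assms(4) orth_complement_span_one)
    moreover have "A = c \<cdot>\<^sub>m 1\<^sub>m N + D"
      using A_carrier by (intro eq_matI) (auto simp: D_def)
    ultimately show ?thesis
      by blast
  qed
  moreover have "c \<cdot>\<^sub>m 1\<^sub>m N + D \<in> ?L" if "D \<in> \<Delta>" for c D
    using that S_L by (intro laplacian_space_add) (auto simp: mat_span_one assms(4))
  ultimately have sum: "?L = V.submodule_sum ?S \<Delta>"
    unfolding V.submodule_sum_def by (auto simp: mat_span_one image_iff)
  \<comment> \<open>Orthogonality to the identity reads c * N = 0, and N is positive.\<close>
  have "c = 0" if "c \<cdot>\<^sub>m 1\<^sub>m N \<in> \<Delta>" for c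
    using that N
    by (simp add: assms(4) orth_complement_span_one mat_inner_smult[of _ N] mat_inner_one)
  then have "?S \<inter> \<Delta> \<subseteq> {0\<^sub>m N N}"
    by (auto simp: mat_span_one V.lmult_0)
  moreover have "0\<^sub>m N N \<in> ?S \<inter> \<Delta>"
    using S_subspace \<Delta>_subspace
    by (auto simp: VectorSpace.subspace_def LinearCombinations.submodule_def module_mat_simps)
  ultimately have inter: "?S \<inter> \<Delta> = {0\<^sub>m N N}"
    by blast
  have "VectorSpace.subspace class_ring (orth_complement N ?L)
      ((mat_space N)\<lparr>carrier := orth_complement N ?S\<rparr>)"
  proof -
    \<comment> \<open>The ambient space is now the complement of the line, with the inherited
      operations. It must be a vector space in its own right; beyond that only the inclusion of the
      smaller complement is new, as its closure properties are those already known in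
      \<open>mat_space N\<close>.\<close>
    have vs: "vectorspace class_ring ((mat_space N)\<lparr>carrier := orth_complement N ?S\<rparr>)"
      by (rule V.subspace_is_vs[OF orth_complement_subspace[OF S_carrier]])
    show ?thesis
      using vs orth_complement_subspace[OF L_carrier] orth_complement_antimono[OF S_L, of N]
      by (auto simp: VectorSpace.subspace_def LinearCombinations.submodule_def vectorspace_def)
  qed
  then show ?thesis
    using S_subspace \<Delta>_subspace sum inter
    by (simp add: internal_direct_sum_def module_mat_simps)
qed

end
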